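(* For every finite nonempty simple graph $G$, the sum index is less than or equal to the exclusive sum number, i.e., $s(G)\leq\epsilon(G)$. Moreover, there exists a finite nonempty simple graph $G$ such that $s(G)<\epsilon(G)$.
   Context: Nonempty means having at least one edge. A vertex labeling of a graph $G$ is an injective map $f:V(G)\to\mathbb{Z}$. It induces the edge labeling $f^+:E(G)\to\mathbb{Z}$, $f^+(uv)=f(u)+f(v)$, and $|f^+|$ denotes the number of distinct values $f^+$ takes on $E(G)$. The sum index $s(G)$ is the minimum positive integer $k$ such that there exists a vertex labeling $f$ of $G$ with $|f^+|=k$. Let $\mathbb{N}$ denote the set of positive integers and $\overline{K_k}$ the graph of $k$ isolated vertices. For a positive integer $k$, a $k$-exclusive sum labeling ($k$-ESL) of $G$ is an injective map $f:V(G\cup\overline{K_k})\to\mathbb{N}$ (disjoint union) such that two (distinct) vertices $v,w\in V(G)$ are adjacent if and only if $f(v)+f(w)=f(u)$ for some vertex $u\in V(\overline{K_k})$. The exclusive sum number $\epsilon(G)$ is the minimum $k$ such that $G$ admits a $k$-ESL. *)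

theory Defs
  imports Main
begin

definition fin_simple_graph :: "'a set \<Rightarrow> 'a set set \<Rightarrow> bool" where
  "fin_simple_graph V E \<longleftrightarrow> finite V \<and> (\<forall>e\<in>E. e \<subseteq> V \<and> card e = 2)"

text \<open>For an edge \<open>e = {u, v}\<close> with \<open>u \<noteq> v\<close> this sum is \<open>f u + f v\<close>.\<close>

definition edge_label :: "('a \<Rightarrow> int) \<Rightarrow> 'a set \<Rightarrow> int" where
  "edge_label f e = (\<Sum>v\<in>e. f v)"

definition sum_index :: "'a set \<Rightarrow> 'a set set \<Rightarrow> nat" where
  "sum_index V E =
     (LEAST k. k > 0 \<and> (\<exists>f :: 'a \<Rightarrow> int. inj_on f V \<and> card (edge_label f ` E) = k))"

text \<open>The disjoint union of \<open>G\<close> with \<open>k\<close> isolated vertices has vertex set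
  \<open>V <+> {..<k}\<close>, the isolated vertices being \<open>Inr u\<close> for \<open>u < k\<close>.\<close>

definition exclusive_sum_labeling ::
    "'a set \<Rightarrow> 'a set set \<Rightarrow> nat \<Rightarrow> ('a + nat \<Rightarrow> nat) \<Rightarrow> bool" where
  "exclusive_sum_labeling V E k f \<longleftrightarrow>
     inj_on f (V <+> {..<k}) \<and>
     (\<forall>x \<in> V <+> {..<k}. f x > 0) \<and>
     (\<forall>v\<in>V. \<forall>w\<in>V. v \<noteq> w \<longrightarrow>
        ({v, w} \<in> E \<longleftrightarrow> (\<exists>u<k. f (Inl v) + f (Inl w) = f (Inr u))))"

definition exclusive_sum_number :: "'a set \<Rightarrow> 'a set set \<Rightarrow> nat" where
  "exclusive_sum_number V E =
     (LEAST k. k > 0 \<and> (\<exists>f. exclusive_sum_labeling V E k f))"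

end

theory Submission
  imports Defs "HOL-Library.Nat_Bijection"
begin

text \<open>An exclusive sum labeling with \<open>k\<close> isolated vertices gives every edge of \<open>G\<close> the label of one
  of those vertices, so its restriction to \<open>G\<close> induces at most \<open>k\<close> edge labels. The inequality
  follows once \<open>exclusive_sum_number\<close> is known to be attained, that is, once every finite graph has
  some exclusive sum labeling: label the vertices by distinct powers of two and give each edge its own
  isolated vertex. By uniqueness of binary expansions no other pair of vertices has the same sum.

  The inequality is strict when every labeling with few edge sums makes some non-edge repeat one of
  these sums. The witness \<open>gap_edges\<close> is the graph \<open>K\<^sub>2\<^sub>,\<^sub>3\<close> with parts \<open>{1, 2}\<close> and \<open>{0, 3, 4}\<close>, together
  with the edge \<open>{0, 3}\<close> and a pendant edge \<open>{0, 5}\<close>. Vertex \<open>0\<close> has degree \<open>4\<close>, so there are at least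
  four edge sums; if there are no more, then each of them occurs at \<open>0\<close>, and the edges avoiding \<open>0\<close>
  become linear equations. Up to an affine change of the labels and the symmetry exchanging \<open>1\<close> and
  \<open>2\<close>, they have only one injective solution: the vertices \<open>4, 0, 3, 1, 2, 5\<close> receive the labels
  \<open>-1, 0, 1, 2, 3, 4\<close>. This solution shows that the sum index is at most \<open>4\<close>. But in it the non-edge
  \<open>{4, 5}\<close> has sum \<open>3\<close>, which is also the sum of \<open>{0, 2}\<close>, so it is not exclusive and the
  exclusive sum number exceeds \<open>4\<close>.\<close>

section \<open>The sum index is at most the exclusive sum number\<close>

lemma fin_simple_graph_finite_edges:
  assumes "fin_simple_graph V E"
  shows "finite E"
  using assms by (auto simp: fin_simple_graph_def intro: finite_subset[of E "Pow V"])

lemma edge_label_doubleton: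
  assumes "u \<noteq> v"
  shows "edge_label f {u, v} = f u + f v"
  using assms by (simp add: edge_label_def)

text \<open>Here \<open>set_encode A\<close> is the number whose binary digits \<open>1\<close> are at the positions in \<open>A\<close>. If the
  vertex \<open>v\<close> has the label \<open>set_encode {g v}\<close>, then two vertices \<open>v \<noteq> w\<close> have the sum
  \<open>set_encode {g v, g w}\<close>, and the isolated vertex belonging to an edge \<open>e\<close> must have the label
  \<open>set_encode (g ` e)\<close>. Edges are not singletons, so all these labels are distinct.\<close>

lemma exclusive_sum_labeling_exists:
  assumes G: "fin_simple_graph V E"
  shows "\<exists>f. exclusive_sum_labeling V E (card E) f"
proof -
  have finV: "finite V" and edges: "\<And>e. e \<in> E \<Longrightarrow> e \<subseteq> V \<and> card e = 2"
    using G by (auto simp: fin_simple_graph_def)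
  obtain g :: "'a \<Rightarrow> nat" where g: "inj_on g V"
    using finite_imp_inj_to_nat_seg[OF finV] by blast
  obtain e where "bij_betw e {0..<card E} E"
    using ex_bij_betw_nat_finite[OF fin_simple_graph_finite_edges[OF G]] by blast
  then have e_inj: "inj_on e {..<card E}" and e_img: "e ` {..<card E} = E"
    by (simp_all add: bij_betw_def lessThan_atLeast0)
  then have e_edge: "e u \<subseteq> V" "card (e u) = 2" if "u < card E" for u
    using that edges[of "e u"] by blast+
  define code where "code = case_sum (\<lambda>v. {v}) e"
  define f where "f x = set_encode (g ` code x)" for x
  have code: "code x \<subseteq> V \<and> code x \<noteq> {}" if "x \<in> V <+> {..<card E}" for x
    using that e_edge by (fastforce simp: code_def)
  have encode_eq: "set_encode (g ` A) = set_encode (g ` B) \<longleftrightarrow> A = B"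
    if "A \<subseteq> V" "B \<subseteq> V" for A B
    using that finV g by (simp add: set_encode_eq finite_subset inj_on_image_eq_iff)
  have "{v} \<noteq> e u" if "u < card E" for v u
    using e_edge(2)[OF that] by (metis card_1_singleton_iff n_not_Suc_n numeral_2_eq_2)
  then have code_inj: "inj_on code (V <+> {..<card E})"
    using e_inj by (fastforce simp: inj_on_def code_def)
  have "inj_on f (V <+> {..<card E})"
  proof (rule inj_onI)
    fix x y assume xy: "x \<in> V <+> {..<card E}" "y \<in> V <+> {..<card E}" and "f x = f y"
    then have "code x = code y"
      using encode_eq[of "code x" "code y"] code[of x] code[of y] by (simp add: f_def)
    then show "x = y"
      using code_inj xy by (simp add: inj_on_eq_iff)
  qed
  moreover have "f x > 0" if "x \<in> V <+> {..<card E}" for x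
  proof -
    have "f x \<noteq> set_encode (g ` {})"
      using code[OF that] encode_eq[of "code x" "{}"] unfolding f_def by blast
    then show ?thesis by simp
  qed
  moreover have "{v, w} \<in> E \<longleftrightarrow> (\<exists>u<card E. f (Inl v) + f (Inl w) = f (Inr u))"
    if vw: "v \<in> V" "w \<in> V" "v \<noteq> w" for v w
  proof -
    have "f (Inl v) + f (Inl w) = set_encode (g ` {v, w})"
      using vw g by (simp add: f_def code_def set_encode_insert inj_on_eq_iff)
    moreover have "f (Inr u) = set_encode (g ` e u)" for u
      by (simp add: f_def code_def)
    ultimately have "(f (Inl v) + f (Inl w) = f (Inr u)) \<longleftrightarrow> {v, w} = e u" if "u < card E" for u
      using vw encode_eq[of "{v, w}" "e u"] e_edge(1)[OF that] by simp
    moreover have "{v, w} \<in> E \<longleftrightarrow> (\<exists>u<card E. {v, w} = e u)"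
      using e_img by blast
    ultimately show ?thesis by blast
  qed
  ultimately show ?thesis
    unfolding exclusive_sum_labeling_def by blast
qed

lemma exclusive_sum_number_attained:
  assumes "fin_simple_graph V E" "E \<noteq> {}"
  shows "exclusive_sum_number V E > 0 \<and>
    (\<exists>f. exclusive_sum_labeling V E (exclusive_sum_number V E) f)"
  unfolding exclusive_sum_number_def
proof (rule LeastI)
  show "card E > 0 \<and> (\<exists>f. exclusive_sum_labeling V E (card E) f)"
    using assms exclusive_sum_labeling_exists fin_simple_graph_finite_edges card_gt_0_iff by blast
qed

lemma sum_index_le:
  assumes "fin_simple_graph V E" "E \<noteq> {}" "inj_on f V"
  shows "sum_index V E \<le> card (edge_label f ` E)"
  unfolding sum_index_def
  using assms fin_simple_graph_finite_edges[of V E] by (intro Least_le) (auto simp: card_gt_0_iff)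

lemma sum_index_le_exclusive_sum_number:
  assumes G: "fin_simple_graph V E" and ne: "E \<noteq> {}"
  shows "sum_index V E \<le> exclusive_sum_number V E"
proof -
  define k where "k = exclusive_sum_number V E"
  obtain f where f: "exclusive_sum_labeling V E k f"
    using exclusive_sum_number_attained[OF assms] unfolding k_def by blast
  define h where "h v = int (f (Inl v))" for v
  have "inj_on h V"
    using f by (auto simp: exclusive_sum_labeling_def inj_on_def h_def)
  then have "sum_index V E \<le> card (edge_label h ` E)"
    by (rule sum_index_le[OF assms])
  also have "edge_label h ` E \<subseteq> (\<lambda>u. int (f (Inr u))) ` {..<k}"
  proof
    fix s assume "s \<in> edge_label h ` E"
    then obtain d where d: "d \<in> E" "s = edge_label h d" by blast
    then obtain v w where vw: "d = {v, w}" "v \<noteq> w" "v \<in> V" "w \<in> V"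
      using G by (auto simp: fin_simple_graph_def card_2_iff)
    then obtain u where "u < k" "f (Inl v) + f (Inl w) = f (Inr u)"
      using f d(1) unfolding exclusive_sum_labeling_def by blast
    then show "s \<in> (\<lambda>u. int (f (Inr u))) ` {..<k}"
      using d vw by (auto simp: edge_label_doubleton h_def simp flip: of_nat_add)
  qed
  then have "card (edge_label h ` E) \<le> k"
    by (metis card_image_le card_lessThan card_mono finite_imageI finite_lessThan order_trans)
  finally show ?thesis unfolding k_def .
qed

section \<open>A graph with strict inequality\<close>

definition gap_edges :: "nat set set" where
  "gap_edges = {{0,1},{0,2},{0,3},{0,5},{1,3},{2,3},{1,4},{2,4}}"

lemma fin_simple_graph_gap: "fin_simple_graph {..<6} gap_edges"
  by (auto simp: fin_simple_graph_def gap_edges_def)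

lemma sum_index_gap_le: "sum_index {..<6} gap_edges \<le> 4"
proof -
  define f :: "nat \<Rightarrow> int" where "f v = [0, 2, 3, 1, -1, 4] ! v" for v
  have "inj_on f {..<6}"
    unfolding f_def by (rule inj_on_nth) auto
  then have "sum_index {..<6} gap_edges \<le> card (edge_label f ` gap_edges)"
    by (intro sum_index_le fin_simple_graph_gap) (simp_all add: gap_edges_def)
  also have "edge_label f ` gap_edges = {1, 2, 3, 4}"
    by (auto simp: gap_edges_def edge_label_doubleton f_def)
  finally show ?thesis by simp
qed

text \<open>Since \<open>1\<close> and \<open>2\<close> are exchangeable, only one of the two ways to satisfy the conditions on the
  triangles \<open>0, 1, 3\<close> and \<open>0, 2, 3\<close> is treated here; it is the hypothesis \<open>p\<close>. Put \<open>t = x3 - x0\<close>.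
  Then \<open>x1, x2, x5\<close> is an arithmetic progression of difference \<open>t\<close>, and what remains is to place \<open>x4\<close>.\<close>

lemma gap_forced_sum_aux:
  fixes x0 x1 x2 x3 x4 x5 :: int
  assumes dist: "distinct [x0, x1, x2, x3, x4, x5]"
    and p: "x1 + x3 = x0 + x2" "x2 + x3 = x0 + x5"
    and q: "x1 + x4 \<in> {x0 + x2, x0 + x3, x0 + x5}" "x2 + x4 \<in> {x0 + x1, x0 + x3, x0 + x5}"
  shows "x4 + x5 = x0 + x2"
proof -
  define t where "t = x3 - x0"
  have x3: "x3 = x0 + t" and x2: "x2 = x1 + t" and x5: "x5 = x1 + 2 * t"
    using p by (simp_all add: t_def)
  consider "x1 + x4 = x0 + x2" | "x1 + x4 = x0 + x5" | "x1 + x4 = x0 + x3"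
    using q(1) by blast
  then show ?thesis
  proof cases
    case 1
    then have "x4 = x3" using x2 x3 by simp
    then show ?thesis using dist by simp
  next
    case 2
    then have x4: "x4 = x0 + 2 * t" using x5 by simp
    \<comment> \<open>The sum \<open>x2 + x4 = x0 + x1 + 3 * t\<close> can then only be \<open>x0 + x3\<close>, which forces \<open>x5 = x0\<close>.\<close>
    then have "x5 = x0" using q(2) x2 x3 x5 dist by auto
    then show ?thesis using dist by simp
  next
    case 3
    \<comment> \<open>With \<open>x1 = x0 + 2 * t\<close> this is the labeling \<open>-1, 0, 1, 2, 3, 4\<close> of \<open>4, 0, 3, 1, 2, 5\<close>, scaled by \<open>t\<close>
      and shifted.\<close>
    then have x4: "x4 = 2 * x0 + t - x1" using x3 by simp
    then have "x1 = x0 + 2 * t" using q(2) x2 x3 x5 dist by auto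
    then show ?thesis using x2 x4 x5 by simp
  qed
qed

text \<open>The membership conditions say that each edge avoiding \<open>0\<close> shares its sum with an edge at \<open>0\<close>;
  injectivity excludes the edges at \<open>0\<close> that meet it.\<close>

lemma gap_forced_sum:
  fixes x0 x1 x2 x3 x4 x5 :: int
  assumes dist: "distinct [x0, x1, x2, x3, x4, x5]"
    and "x1 + x3 \<in> {x0 + x2, x0 + x5}" "x2 + x3 \<in> {x0 + x1, x0 + x5}"
    and q: "x1 + x4 \<in> {x0 + x2, x0 + x3, x0 + x5}" "x2 + x4 \<in> {x0 + x1, x0 + x3, x0 + x5}"
  shows "x4 + x5 \<in> {x0 + x1, x0 + x2}"
proof -
  \<comment> \<open>The other two combinations give \<open>x1 = x2\<close> or \<open>x3 = x0\<close>.\<close>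
  have "x1 \<noteq> x2" "x3 \<noteq> x0"
    using dist by auto
  then consider "x1 + x3 = x0 + x2" "x2 + x3 = x0 + x5" | "x2 + x3 = x0 + x1" "x1 + x3 = x0 + x5"
    using assms(2,3) by fastforce
  then show ?thesis
  proof cases
    case 1
    then show ?thesis using gap_forced_sum_aux[OF dist _ _ q] by simp
  next
    case 2
    moreover have "distinct [x0, x2, x1, x3, x4, x5]" using dist by auto
    ultimately show ?thesis using gap_forced_sum_aux[of x0 x2 x1 x3 x4 x5] q by simp
  qed
qed

lemma gap_no_exclusive_sum_labeling:
  assumes "k \<le> 4"
  shows "\<not> exclusive_sum_labeling {..<6} gap_edges k f"
proof
  assume f: "exclusive_sum_labeling {..<6} gap_edges k f"
  define x where "x v = int (f (Inl v))" for v
  define L where "L = (\<lambda>u. int (f (Inr u))) ` {..<k}"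
  have inj: "inj_on x {..<6}"
    using f by (auto simp: exclusive_sum_labeling_def inj_on_def x_def)
  have adj: "{v, w} \<in> gap_edges \<longleftrightarrow> x v + x w \<in> L" if "v < 6" "w < 6" "v \<noteq> w" for v w
  proof -
    have "{v, w} \<in> gap_edges \<longleftrightarrow> (\<exists>u<k. f (Inl v) + f (Inl w) = f (Inr u))"
      using f that unfolding exclusive_sum_labeling_def by blast
    then show ?thesis
      by (auto simp: x_def L_def simp flip: of_nat_add)
  qed
  have dist: "distinct [x 0, x 1, x 2, x 3, x 4, x 5]"
    using inj by (simp add: inj_on_eq_iff)
  \<comment> \<open>Vertex \<open>0\<close> has four neighbours, so its edges use up all available sums.\<close>
  define S where "S = {x 0 + x 1, x 0 + x 2, x 0 + x 3, x 0 + x 5}"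
  have "S \<subseteq> L"
    using adj[of 0 1] adj[of 0 2] adj[of 0 3] adj[of 0 5] by (simp add: S_def gap_edges_def)
  moreover have "finite L" "card L \<le> 4"
    using assms card_image_le[of "{..<k}" "\<lambda>u. int (f (Inr u))"] by (simp_all add: L_def)
  moreover have "card S = 4"
    using dist by (simp add: S_def)
  ultimately have L: "L = S"
    by (metis card_seteq)
  have "x 1 + x 3 \<in> S" "x 2 + x 3 \<in> S" "x 1 + x 4 \<in> S" "x 2 + x 4 \<in> S"
    using adj[of 1 3] adj[of 2 3] adj[of 1 4] adj[of 2 4] by (simp_all add: L gap_edges_def)
  moreover have "x 0 \<noteq> x 1" "x 0 \<noteq> x 2" "x 0 \<noteq> x 3" "x 0 \<noteq> x 4" "x 1 \<noteq> x 3" "x 2 \<noteq> x 3"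
    using dist by auto
  ultimately have "x 1 + x 3 \<in> {x 0 + x 2, x 0 + x 5}" "x 2 + x 3 \<in> {x 0 + x 1, x 0 + x 5}"
    "x 1 + x 4 \<in> {x 0 + x 2, x 0 + x 3, x 0 + x 5}" "x 2 + x 4 \<in> {x 0 + x 1, x 0 + x 3, x 0 + x 5}"
    by (simp_all add: S_def add.commute)
  then have "x 4 + x 5 \<in> {x 0 + x 1, x 0 + x 2}"
    by (rule gap_forced_sum[OF dist])
  then have "{4, 5} \<in> gap_edges"
    using adj[of 4 5] by (simp add: L S_def) blast
  then show False
    by (simp add: gap_edges_def doubleton_eq_iff)
qed

lemma exclusive_sum_number_gap_gt: "exclusive_sum_number {..<6} gap_edges > 4"
proof -
  have "gap_edges \<noteq> {}" by (simp add: gap_edges_def)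
  then show ?thesis
    using exclusive_sum_number_attained[OF fin_simple_graph_gap] gap_no_exclusive_sum_labeling
    by (meson not_le)
qed

theorem theorem2p5:
  shows "(\<forall>(V :: 'a set) E. fin_simple_graph V E \<and> E \<noteq> {} \<longrightarrow>
            sum_index V E \<le> exclusive_sum_number V E) \<and>
         (\<exists>(V :: nat set) E. fin_simple_graph V E \<and> E \<noteq> {} \<and>
            sum_index V E < exclusive_sum_number V E)"
proof (intro conjI allI impI)
  fix V :: "'a set" and E
  assume "fin_simple_graph V E \<and> E \<noteq> {}"
  then show "sum_index V E \<le> exclusive_sum_number V E"
    by (simp add: sum_index_le_exclusive_sum_number)
next
  have "gap_edges \<noteq> {}" by (simp add: gap_edges_def)
  then show "\<exists>(V :: nat set) E. fin_simple_graph V E \<and> E \<noteq> {} \<and>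
      sum_index V E < exclusive_sum_number V E"
    using fin_simple_graph_gap sum_index_gap_le exclusive_sum_number_gap_gt
    by (meson le_less_trans)
qed

end
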